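(* Let $a\in\mathbb{R}$ and let $n\ge1$ be an integer. For every $f\in E$ and every $x>a$, with $s_1$ real, $0\le s_1<1$, $$\lim_{s_1\to0^+}J^{n+s_1}(f)(x)=J^n(f)(x),\qquad \lim_{s_1\to0^+}J^{n+1-s_1}(f)(x)=J^{n+1}(f)(x).$$
   Context: $E$ denotes the set of integrable and derivable causal functions $f$ on $I=\,]a,+\infty[$: complex-valued functions, differentiable on $]a,+\infty[$, integrable on $]a,x[$ for every $x>a$, and extended by $f(x)=0$ for $x\le a$. For real $s>0$, the $s$-order integral operator is $$J^s(f)(x)=\frac{1}{\Gamma(s)}\int_a^x (x-y)^{s-1}f(y)\,dy,\qquad x>a,$$ where $\Gamma$ is Euler's gamma function; for integer $s=n\ge1$ this is the ordinary $n$-fold iterated integral from $a$ to $x$. *)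

theory Defs
  imports "HOL-Analysis.Analysis"
begin

text \<open>Causal functions: differentiability is that of a complex-valued function of a real
  variable, integrability is in the sense of Lebesgue.\<close>

definition causal_E :: "real \<Rightarrow> (real \<Rightarrow> complex) set" where
  "causal_E a = {f. (\<forall>x>a. f differentiable at x) \<and>
                    (\<forall>x>a. set_integrable lborel {a<..<x} f) \<and>
                    (\<forall>x\<le>a. f x = 0)}"

text \<open>The integral operator of real order \<open>s > 0\<close> with base point \<open>a\<close>; it is only
  meaningful for \<open>x > a\<close>. The same formula is used for integer orders.\<close>

definition frac_J :: "real \<Rightarrow> real \<Rightarrow> (real \<Rightarrow> complex) \<Rightarrow> real \<Rightarrow> complex" where
  "frac_J a s f x =
     (1 / Gamma s) *\<^sub>R (LINT y:{a<..<x}|lborel. ((x - y) powr (s - 1)) *\<^sub>R f y)"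

end

theory Submission
  imports Defs
begin

text \<open>For orders in a bounded interval \<open>[1, K]\<close> the kernel \<open>(x - y) powr (s - 1)\<close> is bounded by
  \<open>max 1 (x - a) powr (K - 1)\<close>, so dominated convergence makes the operator continuous in its
  order. Both limits are instances, with \<open>K = n + 1\<close>.\<close>

lemma continuous_on_frac_J_order:
  fixes f :: "real \<Rightarrow> complex"
  assumes f: "set_integrable lborel {a<..<x} f"
  shows "continuous_on {1..K} (\<lambda>s. frac_J a s f x)"
proof -
  let ?g = "\<lambda>s y. indicator {a<..<x} y *\<^sub>R ((x - y) powr (s - 1)) *\<^sub>R f y"
  let ?F = "\<lambda>y. indicator {a<..<x} y *\<^sub>R f y"
  \<comment> \<open>The \<open>max 1\<close> keeps the base at least 1 even when
    \<open>x - a < 1\<close>, so that raising the exponent from \<open>s - 1\<close> to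
    \<open>K - 1\<close> cannot decrease the power.\<close>
  define B where "B = max 1 (x - a) powr (K - 1)"
  have F: "integrable lborel ?F"
    using f by (simp add: set_integrable_def)
  \<comment> \<open>Measurability is given for the truncated \<open>?F\<close>, not for
    \<open>f\<close> on the whole line, so the indicator is moved next to \<open>f\<close>.\<close>
  have g_eq: "?g s y = ((x - y) powr (s - 1)) *\<^sub>R ?F y" for s y
    by simp
  have g_meas: "?g s \<in> borel_measurable lborel" for s
    unfolding g_eq by (intro borel_measurable_scaleR borel_measurable_integrable[OF F]) measurable
  have g_bound: "norm (?g s y) \<le> B * norm (?F y)" if s: "s \<in> {1..K}" for s y
  proof (cases "y \<in> {a<..<x}")
    case True
    then have "(x - y) powr (s - 1) \<le> max 1 (x - a) powr (s - 1)"
      using s by (intro powr_mono2) auto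
    also have "\<dots> \<le> B"
      unfolding B_def using s by (intro powr_mono) auto
    finally show ?thesis
      using True by (simp add: mult_right_mono)
  qed simp
  have "continuous_on {1..K} (\<lambda>s. LINT y|lborel. ?g s y)"
    \<comment> \<open>Dominated convergence is applied along sequences of orders.\<close>
    unfolding continuous_on_sequentially
  proof (intro allI ballI impI, elim conjE)
    fix X :: "nat \<Rightarrow> real" and s
    assume X: "\<forall>i. X i \<in> {1..K}" and lim: "X \<longlonglongrightarrow> s"
    have pointwise: "(\<lambda>i. ?g (X i) y) \<longlonglongrightarrow> ?g s y" for y
    proof (cases "y \<in> {a<..<x}")
      case True
      \<comment> \<open>Here \<open>x - y\<close> is a fixed nonzero base, so \<open>powr\<close> is
        continuous in its exponent.\<close>
      then show ?thesis by (auto intro!: tendsto_intros lim)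
    qed simp
    have "(\<lambda>i. LINT y|lborel. ?g (X i) y) \<longlonglongrightarrow> (LINT y|lborel. ?g s y)"
    proof (rule integral_dominated_convergence)
      show "integrable lborel (\<lambda>y. B * norm (?F y))"
        using F by (intro integrable_mult_right integrable_norm)
      show "AE y in lborel. norm (?g (X i) y) \<le> B * norm (?F y)" for i
        by (intro AE_I2 g_bound) (use X in blast)
    qed (use g_meas pointwise in \<open>simp_all only: AE_I2\<close>)
    then show "((\<lambda>s. LINT y|lborel. ?g s y) \<circ> X) \<longlonglongrightarrow> (LINT y|lborel. ?g s y)"
      by (simp add: comp_def)
  qed
  then show ?thesis
    unfolding frac_J_def set_lebesgue_integral_def
    \<comment> \<open>\<open>Gamma\<close> has its poles, where it takes the default value 0,
      exactly at the non-positive integers; orders at least 1 avoid them.\<close>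
    by (intro continuous_intros) (auto simp: Gamma_eq_zero_iff elim!: nonpos_Ints_cases)
qed

theorem theorem8:
  fixes a x :: real and n :: nat and f :: "real \<Rightarrow> complex"
  assumes "n \<ge> 1" and "f \<in> causal_E a" and "x > a"
  shows "((\<lambda>s1::real. frac_J a (real n + s1) f x) \<longlongrightarrow> frac_J a (real n) f x) (at_right 0)
       \<and> ((\<lambda>s1::real. frac_J a (real n + 1 - s1) f x) \<longlongrightarrow> frac_J a (real n + 1) f x) (at_right 0)"
proof -
  have cont: "continuous_on {1..real n + 1} (\<lambda>s. frac_J a s f x)"
    using assms by (intro continuous_on_frac_J_order) (simp add: causal_E_def)
  \<comment> \<open>For such \<open>t\<close> and \<open>n \<ge> 1\<close>, both
    \<open>n + t\<close> and \<open>n + 1 - t\<close> stay in the interval of continuity. Its right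
    endpoint is the second limit order, approached from the left.\<close>
  have ev: "eventually (\<lambda>t::real. t \<in> {0<..<1}) (at_right 0)"
    by (rule eventually_at_right_real) simp
  have "((\<lambda>t. real n + t) \<longlongrightarrow> real n + 0) (at_right 0)"
       "((\<lambda>t. real n + 1 - t) \<longlongrightarrow> real n + 1 - 0) (at_right 0)"
    by (intro tendsto_intros)+
  with assms(1) ev show ?thesis
    by (intro conjI continuous_on_tendsto_compose[OF cont]) (auto elim!: eventually_mono)
qed

end
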